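(* Let $n\ge1$ be an integer. The distance spectrum of the friendship graph $F_n$ (the multiset of eigenvalues of its distance matrix $D(F_n)$, superscripts denoting multiplicities) is $$\operatorname{Spec}_{D}(F_n)=\left\{(-3)^{\,n-1},\ (-1)^{\,n},\ \lambda_+,\ \lambda_-\right\},\qquad \lambda_\pm=\frac{4n-3\pm\sqrt{16n^2-16n+9}}{2}.$$
   Context: The distance matrix of a connected graph $\Gamma$ is $D(\Gamma)=(d(u,v))_{u,v\in V(\Gamma)}$, where $d$ is the shortest-path distance. The friendship graph $F_n$ is $K_1\vee(nK_2)$: a single vertex joined to all vertices of $n$ disjoint copies of $K_2$. *)

theory Defs
  imports
    "Graph_Theory.Graph_Theory"
    "Graph_Theory.Shortest_Path"
    "Jordan_Normal_Form.Char_Poly"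
    "HOL-Computational_Algebra.Polynomial"
begin

text \<open>
  Undirected simple graphs are the finite, symmetric, loop-free pair digraphs, that is, the
  instances of \<^locale>\<open>pair_graph\<close>: an edge between \<open>u\<close> and \<open>v\<close> is the pair of arcs
  \<open>(u, v)\<close> and \<open>(v, u)\<close>.
\<close>

definition complete_graph :: "nat \<Rightarrow> nat pair_pre_digraph" where
  "complete_graph m = \<lparr> pverts = {..<m}, parcs = {(u, v). u < m \<and> v < m \<and> u \<noteq> v} \<rparr>"

definition disjoint_copies :: "nat \<Rightarrow> 'a pair_pre_digraph \<Rightarrow> (nat \<times> 'a) pair_pre_digraph" where
  "disjoint_copies n G =
     \<lparr> pverts = {..<n} \<times> pverts G,
       parcs = {((i, u), (i, v)) |i u v. i < n \<and> (u, v) \<in> parcs G} \<rparr>"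

definition graph_join ::
  "'a pair_pre_digraph \<Rightarrow> 'b pair_pre_digraph \<Rightarrow> ('a + 'b) pair_pre_digraph" where
  "graph_join G H =
     \<lparr> pverts = pverts G <+> pverts H,
       parcs = {(Inl u, Inl v) |u v. (u, v) \<in> parcs G}
             \<union> {(Inr u, Inr v) |u v. (u, v) \<in> parcs H}
             \<union> {(Inl u, Inr v) |u v. u \<in> pverts G \<and> v \<in> pverts H}
             \<union> {(Inr v, Inl u) |u v. u \<in> pverts G \<and> v \<in> pverts H} \<rparr>"

definition friendship_graph :: "nat \<Rightarrow> (nat + nat \<times> nat) pair_pre_digraph" where
  "friendship_graph n = graph_join (complete_graph 1) (disjoint_copies n (complete_graph 2))"

text \<open>
  The library's shortest-path weight with unit arc costs. It is infinite between vertices in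
  different components, so the conversion to \<^typ>\<open>real\<close> is meaningful for connected graphs only.
\<close>

definition graph_dist :: "('a, 'b) pre_digraph \<Rightarrow> 'a \<Rightarrow> 'a \<Rightarrow> real" where
  "graph_dist G u v = real_of_ereal (wf_digraph.\<mu> G (\<lambda>_. 1) u v)"

text \<open>
  Matrices have rows and columns indexed by numbers, so the distance matrix is taken with respect
  to a list \<open>vs\<close> that enumerates the vertices without repetition.
\<close>

definition vertex_enumeration :: "('a, 'b) pre_digraph \<Rightarrow> 'a list \<Rightarrow> bool" where
  "vertex_enumeration G vs \<longleftrightarrow> distinct vs \<and> set vs = verts G"

definition distance_matrix :: "('a, 'b) pre_digraph \<Rightarrow> 'a list \<Rightarrow> real mat" where
  "distance_matrix G vs =
     mat (length vs) (length vs) (\<lambda>(i, j). graph_dist G (vs ! i) (vs ! j))"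

text \<open>
  Eigenvalues with algebraic multiplicity. Only real roots are counted, which loses nothing for the
  symmetric matrices considered here, since their characteristic polynomials split over the reals.
\<close>

definition eigenvalue_mset :: "real mat \<Rightarrow> real multiset" where
  "eigenvalue_mset A = proots (char_poly A)"

lemma pair_graph_friendship_graph: "pair_graph (friendship_graph n)"
proof
  show "finite (parcs (friendship_graph n))"
  proof (rule finite_subset)
    show "parcs (friendship_graph n)
        \<subseteq> pverts (friendship_graph n) \<times> pverts (friendship_graph n)"
      by (auto simp: friendship_graph_def graph_join_def disjoint_copies_def complete_graph_def)
    show "finite (pverts (friendship_graph n) \<times> pverts (friendship_graph n))"
      by (auto simp: friendship_graph_def graph_join_def disjoint_copies_def complete_graph_def)
  qed
qed (auto simp: friendship_graph_def graph_join_def disjoint_copies_def complete_graph_def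
    symmetric_def sym_def arcs_ends_def arc_to_ends_def with_proj_def)

text \<open>For symmetric digraphs, strong connectedness is connectedness of the undirected graph.\<close>

lemma strongly_connected_friendship_graph: "strongly_connected (with_proj (friendship_graph n))"
proof -
  interpret pair_graph "friendship_graph n"
    by (rule pair_graph_friendship_graph)
  let ?G = "with_proj (friendship_graph n)"
  let ?c = "Inl 0 :: nat + nat \<times> nat"
  have c: "?c \<in> verts ?G"
    by (auto simp: friendship_graph_def graph_join_def complete_graph_def with_proj_def)
  have to_c: "v \<rightarrow>\<^sup>*\<^bsub>?G\<^esub> ?c \<and> ?c \<rightarrow>\<^sup>*\<^bsub>?G\<^esub> v" if v: "v \<in> verts ?G" for v
  proof (cases "v = ?c")
    case True
    with c show ?thesis by (simp add: reachable_refl)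
  next
    case False
    with v have "(v, ?c) \<in> arcs_ends ?G" "(?c, v) \<in> arcs_ends ?G"
      by (auto simp: friendship_graph_def graph_join_def disjoint_copies_def complete_graph_def
          arcs_ends_def arc_to_ends_def with_proj_def)
    then show ?thesis by (auto intro: reachable_adjI)
  qed
  show ?thesis
    using c to_c by (intro strongly_connectedI) (auto intro: reachable_trans)
qed

end

theory Submission
  imports Defs
begin

text \<open>
  Write \<open>c\<close> for the centre (\<open>Inl 0\<close>) and \<open>i\<^sub>0, i\<^sub>1\<close> for the two other vertices of the triangle
  \<open>i < n\<close> (\<open>Inr (i, 0)\<close> and \<open>Inr (i, 1)\<close>); \<open>e\<close> with a vertex as subscript is a unit vector.
  Distances are \<open>1\<close> inside a triangle and \<open>2\<close> between non-central vertices of different triangles,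
  so the distance matrix \<open>D\<close> preserves the plane of vectors that are constant off the centre. On it,
  \<open>D\<close> has trace \<open>4 n - 3\<close> and determinant \<open>- 2 n\<close>, which gives \<open>\<lambda>\<^sub>+\<close> and \<open>\<lambda>\<^sub>-\<close>. Modulo this plane the
  triangles no longer interact, because a non-central column of \<open>D\<close> differs from the constant \<open>2\<close>
  only at the centre and inside its own triangle: there \<open>D\<close> maps \<open>e\<^bsub>i0\<^esub> + e\<^bsub>i1\<^esub>\<close> to \<open>- 3\<close> times
  itself, and \<open>e\<^bsub>i1\<^esub>\<close> to \<open>- e\<^bsub>i1\<^esub>\<close> up to a multiple of \<open>e\<^bsub>i0\<^esub> + e\<^bsub>i1\<^esub>\<close>. The sum of all
  \<open>e\<^bsub>i0\<^esub> + e\<^bsub>i1\<^esub>\<close> lies in the plane, so \<open>- 3\<close> occurs \<open>n - 1\<close> times and \<open>- 1\<close> occurs \<open>n\<close> times.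

  Only the characteristic polynomial matters, so a basis in which \<open>D\<close> is triangular is enough. It
  is preferable to a basis of eigenvectors because all entries are then polynomial in
  \<open>\<mu> = \<lambda>\<^sub>-\<close> and the dual basis consists of functionals that read at most two entries of a vector.
  The principle is \<open>proots_char_poly_triangular_basis\<close>; its basis is indexed by the vertices
  themselves, with a rank function giving the triangular order, so the result holds for every
  enumeration of the vertices at once. The hypotheses of that lemma are finite checks once
  \<open>sum_friendship_dist_basis\<close> has computed the images of the basis vectors and
  \<open>sum_friendship_dual\<close> has evaluated the dual functionals.
\<close>

section \<open>Eigenvalues from a triangularising basis\<close>

lemma sum_list_index:
  assumes "distinct xs"
  shows "(\<Sum>i<length xs. h (xs ! i)) = (\<Sum>x\<in>set xs. h x)"
  using sum.reindex_bij_betw[OF bij_betw_nth[OF assms refl refl], of h] .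

text \<open>
  The vectors \<open>f b\<close> form a basis with dual basis \<open>g a\<close>, and the sum in \<open>tri\<close> and \<open>diag\<close> is the
  coefficient of \<open>f a\<close> in the image of \<open>f b\<close> (of \<open>f a\<close>, for \<open>diag\<close>) under the operator \<open>D\<close>.
  Sorting the basis by rank makes the matrix of the operator upper triangular. Equal ranks are
  allowed between basis vectors whose images do not involve one another, so a rank needs to separate
  only the levels of the filtration.
\<close>

lemma proots_char_poly_triangular_basis:
  fixes D f g :: "'v \<Rightarrow> 'v \<Rightarrow> real" and rank :: "'v \<Rightarrow> nat" and t :: "'v \<Rightarrow> real"
  assumes vs: "distinct vs"
    and dual: "\<And>a b. a \<in> set vs \<Longrightarrow> b \<in> set vs \<Longrightarrow>
                 (\<Sum>v\<in>set vs. g a v * f b v) = of_bool (a = b)"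
    and tri: "\<And>a b. a \<in> set vs \<Longrightarrow> b \<in> set vs \<Longrightarrow> a \<noteq> b \<Longrightarrow> rank b \<le> rank a \<Longrightarrow>
                 (\<Sum>v\<in>set vs. g a v * (\<Sum>w\<in>set vs. D v w * f b w)) = 0"
    and diag: "\<And>a. a \<in> set vs \<Longrightarrow>
                 (\<Sum>v\<in>set vs. g a v * (\<Sum>w\<in>set vs. D v w * f a w)) = t a"
  shows "proots (char_poly (mat (length vs) (length vs) (\<lambda>(i, j). D (vs ! i) (vs ! j))))
           = image_mset t (mset vs)"
proof -
  define N where "N = length vs"
  define us where "us = sort_key rank vs"
  have us: "length us = N" "set us = set vs" "distinct us" "mset us = mset vs"
    using vs by (simp_all add: us_def N_def)
  have nth [simp]: "us ! i \<in> set vs" "vs ! i \<in> set vs" if "i < N" for i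
    using that us by (metis nth_mem, simp add: N_def)
  \<comment> \<open>The rows of \<open>P\<close> follow the enumeration \<open>vs\<close> of the coordinates, its columns the sorted basis
    \<open>us\<close>; the two orders are unrelated.\<close>
  define A where "A = mat N N (\<lambda>(i, j). D (vs ! i) (vs ! j))"
  define P where "P = mat N N (\<lambda>(i, j). f (us ! j) (vs ! i))"
  define Q where "Q = mat N N (\<lambda>(i, j). g (us ! i) (vs ! j))"
  define B where "B = Q * (A * P)"
  have carrier [simp]: "A \<in> carrier_mat N N" "P \<in> carrier_mat N N" "Q \<in> carrier_mat N N"
      "B \<in> carrier_mat N N"
    by (auto simp: A_def P_def Q_def B_def)
  have sum_index: "(\<Sum>k<N. h (vs ! k)) = (\<Sum>v\<in>set vs. h v)" for h :: "'v \<Rightarrow> real"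
    unfolding N_def by (rule sum_list_index[OF vs])
  have QP: "Q * P = 1\<^sub>m N"
  proof (rule eq_matI)
    fix i j assume "i < dim_row (1\<^sub>m N :: real mat)" "j < dim_col (1\<^sub>m N :: real mat)"
    then have ij: "i < N" "j < N" by auto
    then have "(Q * P) $$ (i, j) = (\<Sum>k<N. g (us ! i) (vs ! k) * f (us ! j) (vs ! k))"
      by (simp add: Q_def P_def scalar_prod_def lessThan_atLeast0)
    also have "\<dots> = of_bool (us ! i = us ! j)"
      using ij by (simp add: sum_index[of "\<lambda>v. g (us ! i) v * f (us ! j) v"] dual)
    finally show "(Q * P) $$ (i, j) = (1\<^sub>m N :: real mat) $$ (i, j)"
      using ij us by (simp add: nth_eq_iff_index_eq)
  qed (auto simp: Q_def P_def)
  then have PQ: "P * Q = 1\<^sub>m N"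
    by (rule mat_mult_left_right_inverse[OF carrier(3,2)])
  have AP: "(A * P) $$ (k, j) = (\<Sum>w\<in>set vs. D (vs ! k) w * f (us ! j) w)"
    if "k < N" "j < N" for k j
    using that by (simp add: A_def P_def scalar_prod_def lessThan_atLeast0[symmetric]
        sum_index[of "\<lambda>w. D (vs ! k) w * f (us ! j) w"])
  have B: "B $$ (i, j) =
      (\<Sum>v\<in>set vs. g (us ! i) v * (\<Sum>w\<in>set vs. D v w * f (us ! j) w))"
    if "i < N" "j < N" for i j
  proof -
    have "B $$ (i, j) = (\<Sum>k<N. Q $$ (i, k) * (A * P) $$ (k, j))"
      using that by (simp add: B_def Q_def A_def P_def scalar_prod_def lessThan_atLeast0)
    also have "\<dots> = (\<Sum>k<N. g (us ! i) (vs ! k) *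
                        (\<Sum>w\<in>set vs. D (vs ! k) w * f (us ! j) w))"
      using that by (intro sum.cong) (auto simp: AP Q_def)
    finally show ?thesis
      by (simp add: sum_index[of "\<lambda>v. g (us ! i) v * (\<Sum>w\<in>set vs. D v w * f (us ! j) w)"])
  qed
  have "upper_triangular B"
  proof (rule upper_triangularI)
    fix i j assume "j < i" "i < dim_row B"
    then have ij: "j < i" "i < N" "j < N" by (auto simp: B_def Q_def)
    have "sorted (map rank us)" by (simp add: us_def)
    then have "rank (us ! j) \<le> rank (us ! i)"
      using ij us sorted_nth_mono[of "map rank us" j i] by simp
    moreover have "us ! i \<noteq> us ! j"
      using ij us by (simp add: nth_eq_iff_index_eq)
    ultimately show "B $$ (i, j) = 0"
      using ij by (simp add: B tri)
  qed
  moreover have "diag_mat B = map t us"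
    using us carrier_matD(1)[OF carrier(4)]
    by (intro nth_equalityI) (auto simp: diag_mat_def B diag)
  ultimately have "char_poly B = (\<Prod>a\<leftarrow>map t us. [:- a, 1:])"
    using char_poly_upper_triangular[of B N] by simp
  moreover have "char_poly A = char_poly B"
  proof (rule char_poly_similar, rule similar_matI)
    have "P * B * Q = (P * Q) * (A * (P * Q))"
      unfolding B_def
      by (simp add: assoc_mult_mat[of _ N N _ N _ N] mult_carrier_mat[of _ N N _ N])
    then show "A = P * B * Q"
      by (simp add: PQ left_mult_one_mat[of _ N N] right_mult_one_mat[of _ N N])
  qed (auto simp: PQ QP)
  ultimately have "char_poly A = (\<Prod>p\<leftarrow>map (\<lambda>a. [:- t a, 1:]) us. p)"
    by (simp add: comp_def)
  moreover have "proots (\<Prod>p\<leftarrow>map (\<lambda>a. [:- t a, 1:]) us. p) = image_mset t (mset us)"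
  proof -
    have "(\<Sum>a\<leftarrow>xs. {#t a#}) = image_mset t (mset xs)" for xs
      by (induction xs) auto
    then show ?thesis
      by (subst proots_prod_list) (auto simp: comp_def)
  qed
  ultimately show ?thesis
    by (simp add: A_def N_def us)
qed

section \<open>Distances in the friendship graph\<close>

text \<open>
  With unit costs the cost of a walk is its length, so the infimum over all walks is attained by any
  walk of least length.
\<close>

lemma graph_dist_eqI:
  assumes "wf_digraph G" and p: "pre_digraph.awalk G u p v"
    and least: "\<And>q. pre_digraph.awalk G u q v \<Longrightarrow> length p \<le> length q"
  shows "graph_dist G u v = real (length p)"
proof -
  interpret wf_digraph G by fact
  have cost: "awalk_cost (\<lambda>_. 1) q = real (length q)" for q
    by (induction q) auto
  have "\<mu> (\<lambda>_. 1) u v = ereal (real (length p))"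
    unfolding \<mu>_def cost
  proof (rule antisym)
    show "(INF q\<in>{q. awalk u q v}. ereal (real (length q))) \<le> ereal (real (length p))"
      using p by (auto intro: INF_lower2)
    show "ereal (real (length p)) \<le> (INF q\<in>{q. awalk u q v}. ereal (real (length q)))"
      using least by (auto intro!: INF_greatest)
  qed
  then show ?thesis
    by (simp add: graph_dist_def)
qed

text \<open>The centre is unique, so the first equation is the distance of the centre to itself.\<close>

fun friendship_dist :: "nat + nat \<times> nat \<Rightarrow> nat + nat \<times> nat \<Rightarrow> real" where
  "friendship_dist (Inl _) (Inl _) = 0"
| "friendship_dist (Inl _) (Inr _) = 1"
| "friendship_dist (Inr _) (Inl _) = 1"
| "friendship_dist (Inr (i, x)) (Inr (j, y)) =
     (if i \<noteq> j then 2 else if x \<noteq> y then 1 else 0)"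

lemma pverts_friendship_graph:
  "pverts (friendship_graph n) = insert (Inl 0) (Inr ` ({..<n} \<times> {..<2}))"
  by (auto simp: friendship_graph_def graph_join_def disjoint_copies_def complete_graph_def)

lemma parcs_friendship_graph_iff:
  assumes "u \<in> pverts (friendship_graph n)" "v \<in> pverts (friendship_graph n)"
  shows "(u, v) \<in> parcs (friendship_graph n) \<longleftrightarrow> friendship_dist u v = 1"
  using assms
  by (auto simp: friendship_graph_def graph_join_def disjoint_copies_def complete_graph_def
      split: if_splits)

lemma graph_dist_friendship_graph:
  assumes u: "u \<in> pverts (friendship_graph n)" and v: "v \<in> pverts (friendship_graph n)"
  shows "graph_dist (with_proj (friendship_graph n)) u v = friendship_dist u v"
proof -
  interpret pair_graph "friendship_graph n"
    by (rule pair_graph_friendship_graph)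
  let ?G = "with_proj (friendship_graph n)"
  note arc = parcs_friendship_graph_iff[of _ n]
  have wf: "wf_digraph ?G" by unfold_locales
  have "u = v \<or> u \<noteq> v \<and> friendship_dist u v = 1
      \<or> (\<exists>i x j y. u = Inr (i, x) \<and> v = Inr (j, y) \<and> i \<noteq> j)"
    using u v by (cases u; cases v) (auto simp: pverts_friendship_graph)
  then consider "u = v" | "u \<noteq> v" "friendship_dist u v = 1"
    | i x j y where "u = Inr (i, x)" "v = Inr (j, y)" "i \<noteq> j"
    by blast
  then show ?thesis
  proof cases
    case 1
    then have "awalk u [] v" using u by (simp add: awalk_Nil_iff)
    from graph_dist_eqI[OF wf this] show ?thesis
      using 1 by (cases v) auto
  next
    case 2
    then have "awalk u [(u, v)] v" using u v by (simp add: awalk_simps arc)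
    moreover have "1 \<le> length q" if "awalk u q v" for q
      using that 2 by (cases q) (auto simp: awalk_simps)
    ultimately show ?thesis
      using graph_dist_eqI[OF wf, of u "[(u, v)]" v] 2 by simp
  next
    case 3
    have c: "Inl 0 \<in> pverts (friendship_graph n)"
      by (simp add: pverts_friendship_graph)
    \<comment> \<open>The detour through the centre is a shortest walk, since the two vertices are not adjacent.\<close>
    have "awalk u [(u, Inl 0), (Inl 0, v)] v"
      using 3 u v c by (simp add: awalk_simps arc)
    moreover have "2 \<le> length q" if "awalk u q v" for q
    proof (rule ccontr)
      assume "\<not> 2 \<le> length q"
      then consider "q = []" | e where "q = [e]"
        by (cases q; cases "tl q") auto
      then show False
      proof cases
        case 1
        with that 3 show False by (auto simp: awalk_simps)
      next
        case (2 e)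
        with that have "(u, v) \<in> parcs (friendship_graph n)"
          by (cases e) (auto simp: awalk_simps)
        with 3 u v show False by (simp add: arc)
      qed
    qed
    ultimately show ?thesis
      using graph_dist_eqI[OF wf, of u "[(u, Inl 0), (Inl 0, v)]" v] 3
      by fastforce
  qed
qed

section \<open>A triangularising basis for the friendship graph\<close>

lemma sum_friendship_vertices:
  "(\<Sum>v\<in>pverts (friendship_graph n). h v) =
     h (Inl 0) + (\<Sum>i<n. h (Inr (i, 0)) + h (Inr (i, 1)) :: real)"
proof -
  have "(\<Sum>v\<in>pverts (friendship_graph n). h v) =
          h (Inl 0) + (\<Sum>p\<in>{..<n} \<times> {..<2}. h (Inr p))"
    unfolding pverts_friendship_graph by (subst sum.insert) (auto simp: sum.reindex)
  also have "(\<Sum>p\<in>{..<n} \<times> {..<2}. h (Inr p)) = (\<Sum>i<n. \<Sum>x<2. h (Inr (i, x :: nat)))"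
    by (simp add: sum.cartesian_product)
  finally show ?thesis by (simp add: numeral_2_eq_2)
qed

text \<open>
  In the notation of the introduction, the basis vectors attached to \<open>0\<^sub>0\<close> and \<open>c\<close> span the
  invariant plane; for \<open>i > 0\<close> the vertex \<open>i\<^sub>0\<close> carries \<open>e\<^bsub>i0\<^esub> + e\<^bsub>i1\<^esub>\<close>, and for every \<open>i\<close> the
  vertex \<open>i\<^sub>1\<close> carries \<open>e\<^bsub>i1\<^esub>\<close>. The vector \<open>w\<close> attached to \<open>0\<^sub>0\<close>, with entry \<open>- \<mu>\<close> at the centre and
  \<open>1\<close> elsewhere, is an eigenvector for \<open>4 n - 3 - \<mu>\<close> when \<open>\<mu>\<close> is a root of
  \<open>x\<^sup>2 - (4 n - 3) x - 2 n\<close>, and \<open>D\<close> maps \<open>e\<^bsub>c\<^esub>\<close> to \<open>w + \<mu> e\<^bsub>c\<^esub>\<close>. The vector \<open>w\<close> replaces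
  \<open>e\<^bsub>00\<^esub> + e\<^bsub>01\<^esub>\<close>, which is the sum of all unit vectors off the centre minus the sums belonging to
  the other triangles.
\<close>

fun friendship_basis :: "real \<Rightarrow> nat + nat \<times> nat \<Rightarrow> nat + nat \<times> nat \<Rightarrow> real" where
  "friendship_basis \<mu> (Inl _) v = of_bool (v = Inl 0)"
| "friendship_basis \<mu> (Inr (i, x)) v =
     (if x \<noteq> 0 then of_bool (v = Inr (i, 1))
      else if i \<noteq> 0 then of_bool (v = Inr (i, 0)) + of_bool (v = Inr (i, 1))
      else if v = Inl 0 then - \<mu> else 1)"

text \<open>
  These functionals solve for the coefficients successively: the entry at \<open>0\<^sub>0\<close> sees only the first
  basis vector, whose contribution is then subtracted from the entries at \<open>c\<close> and \<open>i\<^sub>0\<close>; the entry at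
  \<open>i\<^sub>1\<close> exceeds that at \<open>i\<^sub>0\<close> exactly by the coefficient of \<open>e\<^bsub>i1\<^esub>\<close>.
\<close>

fun friendship_dual :: "real \<Rightarrow> nat + nat \<times> nat \<Rightarrow> nat + nat \<times> nat \<Rightarrow> real" where
  "friendship_dual \<mu> (Inl _) v = of_bool (v = Inl 0) + \<mu> * of_bool (v = Inr (0, 0))"
| "friendship_dual \<mu> (Inr (i, x)) v =
     (if x \<noteq> 0 then of_bool (v = Inr (i, 1)) - of_bool (v = Inr (i, 0))
      else if i \<noteq> 0 then of_bool (v = Inr (i, 0)) - of_bool (v = Inr (0, 0))
      else of_bool (v = Inr (0, 0)))"

fun friendship_rank :: "nat + nat \<times> nat \<Rightarrow> nat" where
  "friendship_rank (Inl _) = 1"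
| "friendship_rank (Inr (i, x)) = (if x \<noteq> 0 then 3 else if i \<noteq> 0 then 2 else 0)"

fun friendship_eigenvalue :: "real \<Rightarrow> nat \<Rightarrow> nat + nat \<times> nat \<Rightarrow> real" where
  "friendship_eigenvalue \<mu> n (Inl _) = \<mu>"
| "friendship_eigenvalue \<mu> n (Inr (i, x)) =
     (if x \<noteq> 0 then - 1 else if i \<noteq> 0 then - 3 else 4 * real n - 3 - \<mu>)"

lemma sum_of_bool_mult:
  assumes "finite V" "a \<in> V"
  shows "(\<Sum>v\<in>V. of_bool (v = a) * h v) = (h a :: real)"
    "(\<Sum>v\<in>V. h v * of_bool (v = a)) = (h a :: real)"
  using assms by (simp_all add: of_bool_def if_distrib if_distribR cong: if_cong)

lemma sum_friendship_dual:
  fixes h :: "nat + nat \<times> nat \<Rightarrow> real"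
  defines "dual_sum n \<mu> a \<equiv> (\<Sum>v\<in>pverts (friendship_graph n). friendship_dual \<mu> a v * h v)"
  assumes n: "n \<ge> 1"
  shows "dual_sum n \<mu> (Inl 0) = h (Inl 0) + \<mu> * h (Inr (0, 0))"
    and "dual_sum n \<mu> (Inr (0, 0)) = h (Inr (0, 0))"
    and "0 < i \<Longrightarrow> i < n \<Longrightarrow> dual_sum n \<mu> (Inr (i, 0)) = h (Inr (i, 0)) - h (Inr (0, 0))"
    and "i < n \<Longrightarrow> dual_sum n \<mu> (Inr (i, 1)) = h (Inr (i, 1)) - h (Inr (i, 0))"
proof -
  have "finite (pverts (friendship_graph n))" by (simp add: pverts_friendship_graph)
  note [simp] = sum_of_bool_mult[OF this] pverts_friendship_graph[of n, THEN eqset_imp_iff]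
    distrib_right left_diff_distrib sum.distrib sum_subtractf mult.assoc
    sum_distrib_left[symmetric] dual_sum_def
  show "dual_sum n \<mu> (Inl 0) = h (Inl 0) + \<mu> * h (Inr (0, 0))"
    and "dual_sum n \<mu> (Inr (0, 0)) = h (Inr (0, 0))"
    and "0 < i \<Longrightarrow> i < n \<Longrightarrow> dual_sum n \<mu> (Inr (i, 0)) = h (Inr (i, 0)) - h (Inr (0, 0))"
    and "i < n \<Longrightarrow> dual_sum n \<mu> (Inr (i, 1)) = h (Inr (i, 1)) - h (Inr (i, 0))"
    using n by auto
qed

text \<open>
  Every basis vector except the one attached to \<open>0\<^sub>0\<close> has at most two non-zero entries, so its
  image is a sum of at most two columns. For the remaining one, a non-central vertex has distances
  adding up to \<open>1\<close> to its own triangle (without the centre) and to \<open>4\<close> to each other one, which gives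
  \<open>- \<mu> + 1 + 4 (n - 1)\<close>.
\<close>

lemma sum_friendship_dist_basis:
  defines "D_basis n \<mu> b v \<equiv>
    (\<Sum>w\<in>pverts (friendship_graph n). friendship_dist v w * friendship_basis \<mu> b w)"
  assumes v: "v \<in> pverts (friendship_graph n)"
  shows "D_basis n \<mu> (Inl 0) v = friendship_dist v (Inl 0)"
    and "D_basis n \<mu> (Inr (0, 0)) v = (if v = Inl 0 then 2 * real n else 4 * real n - 3 - \<mu>)"
    and "0 < i \<Longrightarrow> i < n \<Longrightarrow> D_basis n \<mu> (Inr (i, 0)) v =
           friendship_dist v (Inr (i, 0)) + friendship_dist v (Inr (i, 1))"
    and "i < n \<Longrightarrow> D_basis n \<mu> (Inr (i, 1)) v = friendship_dist v (Inr (i, 1))"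
proof -
  have "finite (pverts (friendship_graph n))" by (simp add: pverts_friendship_graph)
  note [simp] = sum_of_bool_mult[OF this] pverts_friendship_graph[of n, THEN eqset_imp_iff]
    distrib_left sum.distrib D_basis_def
  show "D_basis n \<mu> (Inl 0) v = friendship_dist v (Inl 0)"
    and "0 < i \<Longrightarrow> i < n \<Longrightarrow> D_basis n \<mu> (Inr (i, 0)) v =
           friendship_dist v (Inr (i, 0)) + friendship_dist v (Inr (i, 1))"
    and "i < n \<Longrightarrow> D_basis n \<mu> (Inr (i, 1)) v = friendship_dist v (Inr (i, 1))"
    by auto
  show "D_basis n \<mu> (Inr (0, 0)) v = (if v = Inl 0 then 2 * real n else 4 * real n - 3 - \<mu>)"
  proof (cases v)
    case (Inl c)
    then show ?thesis
      using v by (auto simp: sum_friendship_vertices)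
  next
    case (Inr p)
    then obtain i x where ix: "v = Inr (i, x)" "i < n" "x = 0 \<or> x = 1"
      using v by (cases p) (auto simp: less_2_cases_iff)
    have "friendship_dist v (Inr (j, 0)) + friendship_dist v (Inr (j, 1)) =
            4 - 3 * of_bool (j = i)" for j
      using ix by auto
    then have "D_basis n \<mu> (Inr (0, 0)) v = - \<mu> + (\<Sum>j<n. 4 - 3 * of_bool (j = i))"
      using ix by (simp add: sum_friendship_vertices del: sum.distrib)
    also have "(\<Sum>j<n. 4 - 3 * of_bool (j = i)) = 4 * real n - 3"
      using ix by (simp add: sum_subtractf sum_distrib_left[symmetric] of_bool_def)
    finally show ?thesis using ix by simp
  qed
qed

section \<open>The distance spectrum\<close>

lemma friendship_vertex_cases:
  assumes "a \<in> pverts (friendship_graph n)"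
  obtains "a = Inl 0" | "a = Inr (0, 0)"
    | i where "0 < i" "i < n" "a = Inr (i, 0)" | i where "i < n" "a = Inr (i, 1)"
proof -
  from assms consider "a = Inl 0" | i where "i < n" "a = Inr (i, 0)"
    | i where "i < n" "a = Inr (i, 1)"
    by (auto simp: pverts_friendship_graph less_2_cases_iff)
  then show ?thesis
    using that by cases (metis gr0I)+
qed

text \<open>
  The equation for \<open>\<mu>\<close> enters at one place only: it makes the coefficient \<open>2 n + \<mu> (4 n - 3 - \<mu>)\<close> of
  \<open>e\<^bsub>c\<^esub>\<close> in the image of the basis vector attached to \<open>0\<^sub>0\<close> vanish.
\<close>

lemma eigenvalue_mset_friendship_graph:
  assumes n: "n \<ge> 1" and vs: "vertex_enumeration (with_proj (friendship_graph n)) vs"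
    and \<mu>: "\<mu> * (4 * real n - 3 - \<mu>) = - 2 * real n"
  shows "eigenvalue_mset (distance_matrix (with_proj (friendship_graph n)) vs) =
           image_mset (friendship_eigenvalue \<mu> n) (mset vs)"
proof -
  let ?V = "pverts (friendship_graph n)"
  have V: "distinct vs" "set vs = ?V"
    using vs by (simp_all add: vertex_enumeration_def)
  have D: "distance_matrix (with_proj (friendship_graph n)) vs =
      mat (length vs) (length vs) (\<lambda>(i, j). friendship_dist (vs ! i) (vs ! j))"
    unfolding distance_matrix_def
    by (intro cong_mat) (auto simp: graph_dist_friendship_graph V(2)[symmetric])
  have mem: "Inl 0 \<in> ?V" "Inr (0, 0) \<in> ?V"
    "\<And>i. i < n \<Longrightarrow> Inr (i, 0) \<in> ?V" "\<And>i. i < n \<Longrightarrow> Inr (i, 1) \<in> ?V"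
    using n by (auto simp: pverts_friendship_graph)
  note sums = sum_friendship_dual[OF n] sum_friendship_dist_basis mem
  show ?thesis
    unfolding eigenvalue_mset_def D
  proof (rule proots_char_poly_triangular_basis[where f = "friendship_basis \<mu>"
        and g = "friendship_dual \<mu>" and rank = friendship_rank], unfold V(2))
    show "distinct vs" by (rule V)
  next
    fix a b assume "a \<in> ?V" "b \<in> ?V"
    then show "(\<Sum>v\<in>?V. friendship_dual \<mu> a v * friendship_basis \<mu> b v) = of_bool (a = b)"
      by (elim friendship_vertex_cases) (simp_all add: sums del: friendship_dual.simps One_nat_def)
  next
    fix a b assume "a \<in> ?V" "b \<in> ?V" "a \<noteq> b" "friendship_rank b \<le> friendship_rank a"
    then show "(\<Sum>v\<in>?V. friendship_dual \<mu> a v *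
        (\<Sum>w\<in>?V. friendship_dist v w * friendship_basis \<mu> b w)) = 0"
      using \<mu> by (elim friendship_vertex_cases)
        (simp_all add: sums
           del: friendship_dual.simps friendship_basis.simps One_nat_def)
  next
    fix a assume "a \<in> ?V"
    then show "(\<Sum>v\<in>?V. friendship_dual \<mu> a v *
        (\<Sum>w\<in>?V. friendship_dist v w * friendship_basis \<mu> a w)) = friendship_eigenvalue \<mu> n a"
      by (elim friendship_vertex_cases)
        (simp_all add: sums
           del: friendship_dual.simps friendship_basis.simps One_nat_def)
  qed
qed

lemma mset_friendship_eigenvalues:
  assumes n: "n \<ge> 1" and vs: "vertex_enumeration (with_proj (friendship_graph n)) vs"
  shows "image_mset (friendship_eigenvalue \<mu> n) (mset vs) =
           replicate_mset (n - 1) (- 3) + replicate_mset n (- 1) + {# 4 * real n - 3 - \<mu>, \<mu> #}"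
proof -
  define us :: "(nat + nat \<times> nat) list" where
    "us = [Inr (0, 0), Inl 0] @ map (\<lambda>i. Inr (i, 0)) [1..<n] @ map (\<lambda>i. Inr (i, 1)) [0..<n]"
  have "distinct us"
    by (auto simp: us_def distinct_map inj_on_def)
  moreover have "set us = pverts (friendship_graph n)"
    using n by (auto simp: us_def pverts_friendship_graph less_2_cases_iff image_iff)
  ultimately have "mset vs = mset us"
    using vs by (metis set_eq_iff_mset_eq_distinct vertex_enumeration_def with_proj_simps(1))
  moreover have "map (friendship_eigenvalue \<mu> n) us =
      [4 * real n - 3 - \<mu>, \<mu>] @ replicate (n - 1) (- 3) @ replicate n (- 1)"
    by (auto simp: us_def comp_def intro!: nth_equalityI)
  ultimately have "image_mset (friendship_eigenvalue \<mu> n) (mset vs) =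
      mset ([4 * real n - 3 - \<mu>, \<mu>] @ replicate (n - 1) (- 3) @ replicate n (- 1))"
    by (metis mset_map)
  then show ?thesis by simp
qed

theorem corollary4p1:
  fixes n :: nat and vs :: "(nat + nat \<times> nat) list"
  assumes "n \<ge> 1"
    and "vertex_enumeration (with_proj (friendship_graph n)) vs"
  shows "eigenvalue_mset (distance_matrix (with_proj (friendship_graph n)) vs) =
           replicate_mset (n - 1) (-3) + replicate_mset n (-1) +
           {# (4 * real n - 3 + sqrt (16 * real n ^ 2 - 16 * real n + 9)) / 2,
              (4 * real n - 3 - sqrt (16 * real n ^ 2 - 16 * real n + 9)) / 2 #}"
proof -
  define s where "s = sqrt (16 * real n ^ 2 - 16 * real n + 9)"
  define \<mu> where "\<mu> = (4 * real n - 3 - s) / 2"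
  have "16 * real n ^ 2 - 16 * real n + 9 = (4 * real n - 2)\<^sup>2 + 5"
    by (simp add: power2_eq_square algebra_simps)
  \<comment> \<open>The discriminant is positive: both roots are real.\<close>
  then have "0 \<le> 16 * real n ^ 2 - 16 * real n + 9"
    by (metis add_nonneg_nonneg zero_le_numeral zero_le_power2)
  then have s: "s\<^sup>2 = 16 * real n ^ 2 - 16 * real n + 9"
    unfolding s_def by (rule real_sqrt_pow2)
  have other: "4 * real n - 3 - \<mu> = (4 * real n - 3 + s) / 2"
    by (simp add: \<mu>_def field_simps)
  have "\<mu> * (4 * real n - 3 - \<mu>) = ((4 * real n - 3)\<^sup>2 - s\<^sup>2) / 4"
    unfolding other by (simp add: \<mu>_def power2_eq_square algebra_simps)
  also have "\<dots> = - 2 * real n"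
    unfolding s by (simp add: power2_eq_square algebra_simps)
  finally have "eigenvalue_mset (distance_matrix (with_proj (friendship_graph n)) vs) =
      replicate_mset (n - 1) (- 3) + replicate_mset n (- 1) + {# (4 * real n - 3 + s) / 2, \<mu> #}"
    using eigenvalue_mset_friendship_graph[OF assms, of \<mu>]
      mset_friendship_eigenvalues[OF assms, of \<mu>] other by simp
  then show ?thesis
    unfolding \<mu>_def s_def .
qed

end
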